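(* Let $\Gamma$ be a countably infinite group. For every finite normal subgroup $H \lhd \Gamma$ and every integer $k \geq 2$, there is a continuous $\Gamma$-equivariant map $\pi \colon \mathrm{Free}(k^\Gamma) \to \mathcal{X}_H$ such that $\mathrm{Stab}(\pi) = H$, where $\mathcal{X}_H \subseteq 2^\Gamma$ is the set of all functions $x\colon\Gamma\to 2$ that are constant on the cosets of $H$.
   Context: $\Gamma$ is a countably infinite group with identity $\mathbf{1}$. An integer $k$ is identified with the discrete set $\{0,1,\ldots,k-1\}$. $k^\Gamma$ is the set of functions $\Gamma \to k$ with the product topology, and the (Bernoulli) shift action $\Gamma \curvearrowright k^\Gamma$ is $(\gamma\cdot x)(\delta) = x(\delta\gamma)$ for $x \in k^\Gamma$, $\gamma,\delta\in\Gamma$. $\mathrm{Stab}(x)$ is the stabilizer of $x$, and $\mathrm{Free}(k^\Gamma) = \{x \in k^\Gamma : \mathrm{Stab}(x) = \{\mathbf{1}\}\}$ (with the subspace topology). For a $\Gamma$-equivariant map $\pi\colon X \to Y$ between sets with $\Gamma$-actions, $\mathrm{Stab}(\pi) = \bigcap\{\mathrm{Stab}(\pi(x)) : x\in X\}$, i.e., the set of $\gamma\in\Gamma$ fixing every point in the image of $\pi$. *)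

theory Defs
  imports "HOL-Analysis.Analysis" "HOL-Algebra.Group_Action"
begin

text \<open>Functions on the group are represented extensionally: a point of \<open>k\<^sup>\<Gamma>\<close> is a function
  that is \<open>undefined\<close> outside the carrier. The set \<open>{..<k}\<close> is the integer \<open>k\<close>.\<close>

definition bernoulli_topology :: "('a, 'b) monoid_scheme \<Rightarrow> nat \<Rightarrow> ('a \<Rightarrow> nat) topology" where
  "bernoulli_topology G k = product_topology (\<lambda>_. discrete_topology {..<k}) (carrier G)"

definition shift :: "('a, 'b) monoid_scheme \<Rightarrow> 'a \<Rightarrow> ('a \<Rightarrow> 'c) \<Rightarrow> 'a \<Rightarrow> 'c" where
  "shift G \<gamma> x = (\<lambda>\<delta>\<in>carrier G. x (\<delta> \<otimes>\<^bsub>G\<^esub> \<gamma>))"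

definition free_part :: "('a, 'b) monoid_scheme \<Rightarrow> nat \<Rightarrow> ('a \<Rightarrow> nat) set" where
  "free_part G k =
     {x \<in> carrier G \<rightarrow>\<^sub>E {..<k}. stabilizer G (shift G) x = {\<one>\<^bsub>G\<^esub>}}"

text \<open>Right cosets; the intended use is for normal \<open>H\<close>, where these are also the left cosets.\<close>

definition coset_constant :: "('a, 'b) monoid_scheme \<Rightarrow> 'a set \<Rightarrow> ('a \<Rightarrow> nat) set" where
  "coset_constant G H =
     {x \<in> carrier G \<rightarrow>\<^sub>E {..<2}. \<forall>C \<in> rcosets\<^bsub>G\<^esub> H. x constant_on C}"

definition equivariant_on ::
  "('a, 'b) monoid_scheme \<Rightarrow> ('a \<Rightarrow> 'x \<Rightarrow> 'x) \<Rightarrow> ('a \<Rightarrow> 'y \<Rightarrow> 'y) \<Rightarrow> 'x set \<Rightarrow> ('x \<Rightarrow> 'y) \<Rightarrow> bool"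
  where
  "equivariant_on G \<alpha> \<beta> X \<pi> \<longleftrightarrow> (\<forall>\<gamma>\<in>carrier G. \<forall>x\<in>X. \<pi> (\<alpha> \<gamma> x) = \<beta> \<gamma> (\<pi> x))"

text \<open>The intersection with the carrier matters only for empty \<open>X\<close>.\<close>

definition map_stabilizer ::
  "('a, 'b) monoid_scheme \<Rightarrow> ('a \<Rightarrow> 'y \<Rightarrow> 'y) \<Rightarrow> 'x set \<Rightarrow> ('x \<Rightarrow> 'y) \<Rightarrow> 'a set" where
  "map_stabilizer G \<beta> X \<pi> = carrier G \<inter> (\<Inter>x\<in>X. stabilizer G \<beta> (\<pi> x))"

end

theory Submission
  imports Defs
begin

text \<open>
  The map sends \<open>x\<close> to the indicator of the union of those cosets of \<open>H\<close> on which \<open>x\<close> is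
  constantly \<open>1\<close>. As \<open>H\<close> is finite this is continuous, and elements of \<open>H\<close> act trivially on the
  image. If \<open>\<gamma> \<notin> H\<close>, then since the free part is dense there is a free point equal to
  \<open>1\<close> on \<open>H\<close> and to \<open>0\<close> at \<open>\<gamma>\<close>; its image is moved by \<open>\<gamma>\<close>.
  Density of the free part: enumerate the elements \<open>g\<^sub>n \<noteq> \<one>\<close> and recursively pick \<open>d\<^sub>n\<close>
  so that \<open>d\<^sub>n\<close> and \<open>d\<^sub>n g\<^sub>n\<close> avoid everything used before; a point that is \<open>1\<close> at all
  \<open>d\<^sub>n\<close> and \<open>0\<close> at all \<open>d\<^sub>n g\<^sub>n\<close> is free.
\<close>

text \<open>Each stage excludes only finitely many elements, so an infinite group always leaves a
  choice. The set \<open>F\<close> is reserved for values prescribed later.\<close>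

lemma (in group) separating_sequence:
  fixes g :: "nat \<Rightarrow> 'a"
  assumes "infinite (carrier G)" "finite F" "\<And>n. g n \<in> carrier G - {\<one>}"
  obtains d :: "nat \<Rightarrow> 'a" where
    "\<And>n. d n \<in> carrier G - F" "\<And>n. d n \<otimes> g n \<notin> F" "\<And>m n. d n \<otimes> g n \<noteq> d m"
proof -
  \<comment> \<open>The two inequations for \<open>m < n\<close> treat both orders of the indices:
    the new term must miss the old products, and the new product must miss the old terms.\<close>
  define P where "P d n r \<longleftrightarrow> r \<in> carrier G - F \<and> r \<otimes> g n \<notin> F \<and>
      (\<forall>m<n. r \<noteq> d m \<otimes> g m \<and> r \<otimes> g n \<noteq> d m)"
    for d :: "nat \<Rightarrow> 'a" and n r
  have g: "g n \<in> carrier G" "g n \<noteq> \<one>" for n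
    using assms(3)[of n] by auto
  have "\<exists>d. \<forall>n. P d n (d n)"
  proof (rule dependent_wellorder_choice)
    fix r n and d d' :: "nat \<Rightarrow> 'a"
    assume "\<And>m. m < n \<Longrightarrow> d m = d' m"
    then show "P d n r = P d' n r" by (simp add: P_def)
  next
    fix n and d :: "nat \<Rightarrow> 'a"
    let ?B = "F \<union> d ` {..<n}"
    \<comment> \<open>The translates by \<open>inv (g n)\<close> are the \<open>r\<close> for which
      \<open>r \<otimes> g n\<close> would fall into \<open>?B\<close>.\<close>
    let ?bad = "?B \<union> (\<lambda>b. b \<otimes> inv (g n)) ` ?B \<union> (\<lambda>m. d m \<otimes> g m) ` {..<n}"
    have "finite ?bad" using assms(2) by simp
    then have "infinite (carrier G - ?bad)"
      using assms(1) by (rule Diff_infinite_finite)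
    then obtain r where r: "r \<in> carrier G - ?bad"
      using infinite_imp_nonempty by blast
    have "r \<otimes> g n \<notin> ?B"
    proof
      assume "r \<otimes> g n \<in> ?B"
      then have "r \<otimes> g n \<otimes> inv (g n) \<in> ?bad" by blast
      then show False using r g[of n] by (simp add: m_assoc)
    qed
    with r show "\<exists>r. P d n r" unfolding P_def by blast
  qed
  then obtain d where d: "\<And>n. P d n (d n)" by blast
  show thesis
  proof (rule that)
    show dn: "d n \<in> carrier G - F" "d n \<otimes> g n \<notin> F" for n
      using d[of n] by (auto simp: P_def)
    show "d n \<otimes> g n \<noteq> d m" for m n
    proof (cases rule: linorder_cases[of m n])
      \<comment> \<open>Here \<open>g n \<noteq> \<one>\<close> is what separates the two
        elements.\<close>
      case equal
      then show ?thesis using dn(1)[of n] g[of n] by (simp add: r_cancel_one')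
    qed (use d[of n] d[of m] in \<open>auto simp: P_def\<close>)
  qed
qed

text \<open>The witness is the indicator of \<open>A\<close> together with a separating sequence
  outside \<open>F\<close>: the sequence destroys every nontrivial period without touching the
  values on \<open>F\<close>.\<close>

lemma (in group) ex_free_point_with_prescribed_values:
  assumes "countable (carrier G)" "infinite (carrier G)" "k \<ge> 2"
    and "finite F" "A \<subseteq> F" "A \<subseteq> carrier G"
  obtains x where "x \<in> free_part G k"
    "\<And>a. a \<in> A \<Longrightarrow> x a = 1" "\<And>a. a \<in> carrier G \<inter> F - A \<Longrightarrow> x a = 0"
proof -
  define g where "g = from_nat_into (carrier G - {\<one>})"
  have inf: "infinite (carrier G - {\<one>})" using assms(2) by simp
  then have g: "g n \<in> carrier G - {\<one>}" for n
    unfolding g_def by (metis from_nat_into infinite_imp_nonempty)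
  have g_surj: "\<exists>n. g n = \<gamma>" if "\<gamma> \<in> carrier G" "\<gamma> \<noteq> \<one>" for \<gamma>
    unfolding g_def using that assms(1) by (intro from_nat_into_surj) auto
  obtain d :: "nat \<Rightarrow> 'a" where d: "\<And>n. d n \<in> carrier G - F" "\<And>n. d n \<otimes> g n \<notin> F"
    "\<And>m n. d n \<otimes> g n \<noteq> d m"
    using separating_sequence[of F g] assms(2,4) g by blast
  define x :: "'a \<Rightarrow> nat" where "x = (\<lambda>a\<in>carrier G. of_bool (a \<in> A \<union> range d))"
  have "x \<in> carrier G \<rightarrow>\<^sub>E {..<k}" using assms(3) by (auto simp: x_def)
  moreover have "\<gamma> = \<one>" if \<gamma>: "\<gamma> \<in> carrier G" "shift G \<gamma> x = x" for \<gamma>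
  proof (rule ccontr)
    assume "\<gamma> \<noteq> \<one>"
    then obtain n where n: "g n = \<gamma>" using g_surj \<gamma>(1) by blast
    have "x (d n) = 1" using d(1)[of n] by (simp add: x_def)
    \<comment> \<open>The product avoids \<open>A\<close> because it avoids \<open>F\<close>, and it
      avoids every term of the sequence.\<close>
    moreover have "x (d n \<otimes> \<gamma>) = 0"
      using d(1)[of n] d(2)[of n] d(3)[of n] \<gamma>(1) assms(5) n by (auto simp: x_def)
    moreover have "shift G \<gamma> x (d n) = x (d n \<otimes> \<gamma>)"
      using d(1)[of n] by (simp add: shift_def)
    ultimately show False using \<gamma>(2) by simp
  qed
  moreover have "shift G \<one> x = x"
    by (auto simp: shift_def x_def)
  ultimately have "x \<in> free_part G k"
    unfolding free_part_def stabilizer_def by auto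
  then show thesis
    by (rule that) (use assms(5,6) d(1) in \<open>auto simp: x_def\<close>)
qed

text \<open>A finite intersection of clopen preimages is clopen, and the indicator of a clopen set
  is continuous. This is where finiteness of \<open>H\<close> enters the continuity of
  \<open>\<pi>\<close>.\<close>

lemma continuous_map_of_bool_all_eq:
  assumes "finite C" and f: "\<And>c. c \<in> C \<Longrightarrow> continuous_map X (discrete_topology S) (f c)"
  shows "continuous_map X (discrete_topology {..<2::nat}) (\<lambda>x. of_bool (\<forall>c\<in>C. f c x = v))"
proof -
  have clopen: "openin X {x \<in> topspace X. \<forall>c\<in>C. f c x = v} \<and>
      closedin X {x \<in> topspace X. \<forall>c\<in>C. f c x = v}"
    using assms
  proof (induction C rule: finite_induct)
    case (insert c C)
    have f: "continuous_map X (discrete_topology S) (f c)"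
      using insert.prems by simp
    then have "f c x \<in> S" if "x \<in> topspace X" for x
      using that by (auto simp: continuous_map_def)
    \<comment> \<open>The value \<open>v\<close> may lie outside \<open>S\<close>;
      \<open>S \<inter> {v}\<close> is clopen in the discrete space in either case.\<close>
    then have eq: "{x \<in> topspace X. \<forall>c\<in>insert c C. f c x = v} =
        {x \<in> topspace X. f c x \<in> S \<inter> {v}} \<inter> {x \<in> topspace X. \<forall>c\<in>C. f c x = v}"
      by auto
    have "openin X {x \<in> topspace X. f c x \<in> S \<inter> {v}}"
      using f by (rule openin_continuous_map_preimage) simp
    moreover have "closedin X {x \<in> topspace X. f c x \<in> S \<inter> {v}}"
      using f by (rule closedin_continuous_map_preimage) simp
    moreover have "openin X {x \<in> topspace X. \<forall>c\<in>C. f c x = v}"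
      "closedin X {x \<in> topspace X. \<forall>c\<in>C. f c x = v}"
      using insert by simp_all
    ultimately show ?case
      unfolding eq by (simp only: openin_Int closedin_Int simp_thms)
  qed simp
  let ?E = "{x \<in> topspace X. \<forall>c\<in>C. f c x = v}"
  have "openin X {x \<in> topspace X. of_bool (\<forall>c\<in>C. f c x = v) \<in> U}" for U :: "nat set"
  proof -
    have "{x \<in> topspace X. of_bool (\<forall>c\<in>C. f c x = v) \<in> U} =
        (if 1 \<in> U then ?E else {}) \<union> (if 0 \<in> U then topspace X - ?E else {})"
      unfolding of_bool_def by (cases "1 \<in> U"; cases "0 \<in> U") auto
    moreover have "openin X (topspace X - ?E)"
      using clopen by (intro openin_diff) auto
    ultimately show ?thesis
      using clopen by (simp del: Un_Diff_cancel add: openin_Un)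
  qed
  then show ?thesis by (simp add: continuous_map_def)
qed

text \<open>The shift multiplies on the right, while the cosets in question are
  \<open>H #> \<delta>\<close>. Normality puts \<open>\<delta> \<otimes> h\<close> into that same
  coset.\<close>

lemma (in normal) shift_coset_constant:
  assumes "y \<in> coset_constant G H" "h \<in> H"
  shows "shift G h y = y"
proof
  fix \<delta>
  have y: "y \<in> extensional (carrier G)" "\<And>C. C \<in> rcosets H \<Longrightarrow> y constant_on C"
    using assms(1) by (auto simp: coset_constant_def PiE_def)
  show "shift G h y \<delta> = y \<delta>"
  proof (cases "\<delta> \<in> carrier G")
    case True
    then have "\<delta> \<otimes> h \<in> H #> \<delta>"
      using assms(2) coset_eq by (auto simp: l_coset_def)
    moreover have "\<delta> \<in> H #> \<delta>" using True subgroup_axioms by (rule rcos_self)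
    moreover have "y constant_on (H #> \<delta>)"
      using True by (intro y(2) rcosetsI subset)
    ultimately have "y (\<delta> \<otimes> h) = y \<delta>" unfolding constant_on_def by metis
    with True show ?thesis by (simp add: shift_def)
  next
    case False
    then show ?thesis by (simp add: shift_def extensional_arb[OF y(1)])
  qed
qed

theorem proposition1p4:
  fixes \<Gamma> :: "('a, 'b) monoid_scheme" and H :: "'a set" and k :: nat
  assumes "group \<Gamma>"
    and "countable (carrier \<Gamma>)" and "infinite (carrier \<Gamma>)"
    and "H \<lhd> \<Gamma>" and "finite H"
    and "k \<ge> 2"
  shows "\<exists>\<pi>. continuous_map
                (subtopology (bernoulli_topology \<Gamma> k) (free_part \<Gamma> k))
                (subtopology (bernoulli_topology \<Gamma> 2) (coset_constant \<Gamma> H)) \<pi>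
            \<and> equivariant_on \<Gamma> (shift \<Gamma>) (shift \<Gamma>) (free_part \<Gamma> k) \<pi>
            \<and> map_stabilizer \<Gamma> (shift \<Gamma>) (free_part \<Gamma> k) \<pi> = H"
proof -
  interpret normal H \<Gamma> by fact
  define \<pi> :: "('a \<Rightarrow> nat) \<Rightarrow> 'a \<Rightarrow> nat" where
    "\<pi> x = (\<lambda>\<delta>\<in>carrier \<Gamma>. of_bool (\<forall>c \<in> H #>\<^bsub>\<Gamma>\<^esub> \<delta>. x c = 1))" for x
  have cc: "\<pi> x \<in> coset_constant \<Gamma> H" for x
  proof -
    have "\<pi> x constant_on C" if "C \<in> rcosets\<^bsub>\<Gamma>\<^esub> H" for C
    proof -
      \<comment> \<open>Any element of a coset represents it, so the defining condition at
        \<open>\<delta>\<close> refers to \<open>C\<close> alone.\<close>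
      have "\<pi> x \<delta> = of_bool (\<forall>c \<in> C. x c = 1)" if "\<delta> \<in> C" for \<delta>
      proof -
        obtain a where a: "a \<in> carrier \<Gamma>" "C = H #>\<^bsub>\<Gamma>\<^esub> a"
          using \<open>C \<in> rcosets\<^bsub>\<Gamma>\<^esub> H\<close> by (auto simp: RCOSETS_def)
        have "C = H #>\<^bsub>\<Gamma>\<^esub> \<delta>"
          using repr_independence[of \<delta> H a] a \<open>\<delta> \<in> C\<close> subgroup_axioms by simp
        moreover have "\<delta> \<in> carrier \<Gamma>"
          using a \<open>\<delta> \<in> C\<close> r_coset_subset_G[OF subset] by blast
        ultimately show ?thesis by (simp add: \<pi>_def)
      qed
      then show ?thesis by (auto simp: constant_on_def)
    qed
    then show ?thesis by (auto simp: coset_constant_def \<pi>_def)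
  qed
  have "continuous_map (bernoulli_topology \<Gamma> k) (bernoulli_topology \<Gamma> 2) \<pi>"
    unfolding bernoulli_topology_def continuous_map_componentwise
  proof (intro conjI ballI)
    fix \<delta> assume \<delta>: "\<delta> \<in> carrier \<Gamma>"
    have "finite (H #>\<^bsub>\<Gamma>\<^esub> \<delta>)"
      using assms(5) by (simp add: r_coset_def)
    then show "continuous_map (product_topology (\<lambda>_. discrete_topology {..<k}) (carrier \<Gamma>))
        (discrete_topology {..<2}) (\<lambda>x. \<pi> x \<delta>)"
      using \<delta> r_coset_subset_G[OF subset \<delta>]
      by (simp add: \<pi>_def)
        (intro continuous_map_of_bool_all_eq[where S = "{..<k}"] continuous_map_product_projection, auto)
  qed (auto simp: \<pi>_def)
  then have "continuous_map (subtopology (bernoulli_topology \<Gamma> k) (free_part \<Gamma> k))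
      (subtopology (bernoulli_topology \<Gamma> 2) (coset_constant \<Gamma> H)) \<pi>"
    using cc by (intro continuous_map_into_subtopology continuous_map_from_subtopology) auto
  \<comment> \<open>Right translation by \<open>\<gamma>\<close> carries the coset of
    \<open>\<delta>\<close> onto the coset of \<open>\<delta> \<otimes> \<gamma>\<close>.\<close>
  moreover have "\<pi> (shift \<Gamma> \<gamma> x) = shift \<Gamma> \<gamma> (\<pi> x)" if "\<gamma> \<in> carrier \<Gamma>" for \<gamma> x
    using that by (auto simp: \<pi>_def shift_def r_coset_def m_assoc fun_eq_iff restrict_def)
  then have "equivariant_on \<Gamma> (shift \<Gamma>) (shift \<Gamma>) (free_part \<Gamma> k) \<pi>"
    by (simp add: equivariant_on_def)
  moreover have "H \<subseteq> map_stabilizer \<Gamma> (shift \<Gamma>) (free_part \<Gamma> k) \<pi>"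
    using shift_coset_constant[OF cc] subset
    by (auto simp: map_stabilizer_def stabilizer_def)
  moreover have "\<gamma> \<in> H" if "\<gamma> \<in> map_stabilizer \<Gamma> (shift \<Gamma>) (free_part \<Gamma> k) \<pi>" for \<gamma>
  proof (rule ccontr)
    assume "\<gamma> \<notin> H"
    have \<gamma>: "\<gamma> \<in> carrier \<Gamma>" "\<And>x. x \<in> free_part \<Gamma> k \<Longrightarrow> shift \<Gamma> \<gamma> (\<pi> x) = \<pi> x"
      using that by (auto simp: map_stabilizer_def stabilizer_def)
    obtain x where x: "x \<in> free_part \<Gamma> k" "\<And>a. a \<in> H \<Longrightarrow> x a = 1"
        "\<And>a. a \<in> carrier \<Gamma> \<inter> insert \<gamma> H - H \<Longrightarrow> x a = 0"
      using ex_free_point_with_prescribed_values[OF assms(2,3,6), of "insert \<gamma> H" H]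
        assms(5) subset by blast
    have "\<pi> x \<one>\<^bsub>\<Gamma>\<^esub> = 1"
      using x(2) subset by (simp add: \<pi>_def coset_mult_one)
    \<comment> \<open>One zero in the coset of \<open>\<gamma>\<close> suffices, and
      \<open>\<gamma>\<close> itself provides it.\<close>
    moreover have "\<pi> x \<gamma> = 0"
    proof -
      have "\<gamma> \<in> H #>\<^bsub>\<Gamma>\<^esub> \<gamma>" using \<gamma>(1) subgroup_axioms by (rule rcos_self)
      moreover have "x \<gamma> = 0" using x(3) \<gamma>(1) \<open>\<gamma> \<notin> H\<close> by simp
      ultimately show ?thesis using \<gamma>(1) by (force simp: \<pi>_def)
    qed
    moreover have "shift \<Gamma> \<gamma> (\<pi> x) \<one>\<^bsub>\<Gamma>\<^esub> = \<pi> x \<gamma>"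
      using \<gamma>(1) by (simp add: shift_def)
    ultimately show False using \<gamma>(2)[OF x(1)] by simp
  qed
  ultimately show ?thesis by blast
qed

end
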